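(* Consider the CODA dynamics. Let $A_1,A_2,\dots,A_d\subseteq\mathcal{V}$ be sets such that \begin{itemize} \item $A_1$ is a robust polarized cluster with $q_i(0)=0$ for a certain $i\in A_1$ (and thus $q_i(0)=0$ for all $i\in A_1$); \item for all $h\in\{1,\dots,d-1\}$ and all $i\in A_{h+1}$, $|N_i\cap A_h|>|N_i\setminus A_h|$. \end{itemize} Then for all $h\in\{1,\dots,d\}$ there exists $T_h\in\mathbb{N}$ such that $q_i(k)=0$ for all $k\ge T_h$ and all $i\in A_h$, where one can choose $T_1=0$. Consequently, for all $i\in\bigcup_{h=1}^dA_h$ one has $\displaystyle\lim_{k\to\infty}p_i(k)\le\frac12$.
   Context: $\mathcal{V}=\{1,\dots,n\}$ is a finite set of agents and $\mathcal{G}=(\mathcal{V},\mathcal{E})$ is a fixed graph (directed or undirected, without self-loops; no connectivity is assumed). $N_i=\{j\in\mathcal{V}:(j,i)\in\mathcal{E}\}$ is the set of agents influencing $i$, and $n_i=|N_i|$ (possibly $0$). Time is $k\in\mathbb{N}=\{0,1,2,\dots\}$. Each agent has an opinion $p_i(k)$, with initial opinions $p_i(0)\in(0,1)$, $p_i(0)\ne\frac12$, and an action $q_i(k)\in\{0,1\}$ defined by: $q_i(k)=0$ if $p_i(k)<\frac12$; $q_i(k)=0$ if $p_i(k)=\frac12$ and $p_i(k-1)<\frac12$; $q_i(k)=1$ otherwise. The CODA (continuous opinions, discrete actions) dynamics is $$p_i(k+1)=p_i(k)+\frac{p_i(k)(1-p_i(k))}{n_i}\sum_{j\in N_i}(q_j(k)-p_i(k)),\qquad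 i\in\mathcal{V},\ k\in\mathbb{N},$$ with the convention that $p_i(k+1)=p_i(k)$ if $n_i=0$. A subset $A\subseteq\mathcal{V}$ is a robust polarized cluster if (i) $q_i(0)=q_j(0)$ for all $i,j\in A$, and (ii) $|N_i\cap A|\ge|N_i\setminus A|$ for all $i\in A$, where $|\cdot|$ denotes cardinality.
   Formalization: The limit of p_i(k) need not exist under these hypotheses, so the last claim is stated as: the limit superior of p_i(k) is at most 1/2, and if p_i(k) converges, then its limit is at most 1/2. *)

theory Defs
  imports Complex_Main "HOL-Library.Extended_Real"
begin

text \<open>
  A graph is given by its vertex set \<open>V\<close> and edge relation \<open>E\<close>; \<open>(j, i) \<in> E\<close> means that \<open>j\<close>
  influences \<open>i\<close>. An undirected graph is the special case of a symmetric \<open>E\<close>. Opinions are given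
  as \<open>p i k\<close>, for agent \<open>i\<close> at time \<open>k\<close>.
\<close>

definition loopfree_graph :: "'a set \<Rightarrow> ('a \<times> 'a) set \<Rightarrow> bool" where
  "loopfree_graph V E \<longleftrightarrow> finite V \<and> E \<subseteq> V \<times> V \<and> irrefl E"

definition influencers :: "'a set \<Rightarrow> ('a \<times> 'a) set \<Rightarrow> 'a \<Rightarrow> 'a set" where
  "influencers V E i = {j \<in> V. (j, i) \<in> E}"

text \<open>
  The guard \<open>k > 0\<close> only makes explicit that there is no opinion before time \<open>0\<close>. A trajectory
  starts away from \<open>1/2\<close>, so the tie-breaking clause is never needed at \<open>k = 0\<close>.
\<close>

definition action :: "('a \<Rightarrow> nat \<Rightarrow> real) \<Rightarrow> 'a \<Rightarrow> nat \<Rightarrow> nat" where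
  "action p i k =
     (if p i k < 1/2 then 0
      else if k > 0 \<and> p i k = 1/2 \<and> p i (k - 1) < 1/2 then 0
      else 1)"

definition coda_trajectory :: "'a set \<Rightarrow> ('a \<times> 'a) set \<Rightarrow> ('a \<Rightarrow> nat \<Rightarrow> real) \<Rightarrow> bool" where
  "coda_trajectory V E p \<longleftrightarrow>
     (\<forall>i\<in>V. 0 < p i 0 \<and> p i 0 < 1 \<and> p i 0 \<noteq> 1/2) \<and>
     (\<forall>i\<in>V. \<forall>k. p i (Suc k) =
        (if card (influencers V E i) = 0 then p i k
         else p i k + p i k * (1 - p i k) / real (card (influencers V E i)) *
           (\<Sum>j\<in>influencers V E i. real (action p j k) - p i k)))"

definition robust_polarized_cluster ::
    "'a set \<Rightarrow> ('a \<times> 'a) set \<Rightarrow> ('a \<Rightarrow> nat \<Rightarrow> real) \<Rightarrow> 'a set \<Rightarrow> bool" where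
  "robust_polarized_cluster V E p A \<longleftrightarrow>
     A \<subseteq> V \<and>
     (\<forall>i\<in>A. \<forall>j\<in>A. action p i 0 = action p j 0) \<and>
     (\<forall>i\<in>A. card (influencers V E i \<inter> A) \<ge> card (influencers V E i - A))"

end

theory Submission
  imports Defs
begin

text \<open>
  Along the dynamics \<open>p' = p + p (1 - p) (a - p)\<close>, where \<open>a\<close> is the mean action of the influencers.
  If \<open>p < 1/2\<close> and \<open>a \<le> 1/2\<close> then \<open>p' < 1/2\<close> strictly, so the tie-breaking rule at \<open>1/2\<close> never
  matters; this gives the invariance of \<open>A 1\<close>. If \<open>A h\<close> has settled at action \<open>0\<close>, an agent of
  \<open>A (h + 1)\<close> has \<open>a \<le> c\<close> for a constant \<open>c < 1/2\<close>, so that \<open>p\<close> decreases by at least a fixed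
  amount at each step as long as \<open>p \<ge> 1/2\<close>, and hence falls below \<open>1/2\<close> in finite time.
\<close>

section \<open>The scalar recursion\<close>

lemma coda_step_bounds:
  fixes x a :: real
  assumes "0 < x" "x < 1" "0 \<le> a" "a \<le> 1"
  shows "0 < x + x * (1 - x) * (a - x)" "x + x * (1 - x) * (a - x) < 1"
proof -
  \<comment> \<open>The increment is at most \<open>x * (1 - x)\<close> in absolute value, less than
    the distances \<open>x\<close> and \<open>1 - x\<close> to the ends of the interval.\<close>
  have "x * (1 - x) * (x - a) \<le> x * (1 - x) * 1"
    using assms by (intro mult_left_mono) auto
  moreover have "x * (1 - x) < x"
    using assms by simp
  ultimately show "0 < x + x * (1 - x) * (a - x)"
    by (simp add: algebra_simps)
  have "(1 - x) * x * (a - x) \<le> (1 - x) * x * 1"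
    using assms by (intro mult_left_mono) auto
  moreover have "(1 - x) * x < 1 - x"
    using assms by simp
  ultimately show "x + x * (1 - x) * (a - x) < 1"
    by (simp add: algebra_simps)
qed

text \<open>The increment is at most the fraction \<open>x * (1 - x) < 1\<close> of the gap
  \<open>1/2 - x\<close>, so it cannot close that gap.\<close>

lemma coda_step_less_half:
  fixes x a :: real
  assumes "0 < x" "x < 1/2" "a \<le> 1/2"
  shows "x + x * (1 - x) * (a - x) < 1/2"
proof -
  have "x * (1 - x) * (a - x) \<le> x * (1 - x) * (1/2 - x)"
    using assms by (intro mult_left_mono) auto
  moreover have "x * (1 - x) < 1 * 1"
    using assms by (intro mult_strict_mono) auto
  then have "x * (1 - x) * (1/2 - x) < 1 * (1/2 - x)"
    using assms by (intro mult_strict_right_mono) auto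
  ultimately show ?thesis by simp
qed

lemma coda_step_below_half_eventually:
  fixes x a :: "nat \<Rightarrow> real"
  assumes x: "\<And>k. 0 < x k" "\<And>k. x k < 1"
    and step: "\<And>k. x (Suc k) = x k + x k * (1 - x k) * (a k - x k)"
    and a: "\<And>k. k \<ge> T \<Longrightarrow> a k \<le> c" and c: "c < 1/2"
  shows "\<forall>\<^sub>F k in sequentially. x k < 1/2"
proof -
  have "\<exists>k\<ge>T. x k < 1/2"
  proof (rule ccontr)
    assume "\<not> ?thesis"
    then have ge: "x k \<ge> 1/2" if "k \<ge> T" for k
      using that by force
    \<comment> \<open>A lower bound for the decrease while \<open>1/2 \<le> x k \<le> x T\<close>:
      the factors \<open>x k\<close>, \<open>1 - x k\<close> and \<open>x k - a k\<close> are
      bounded below separately.\<close>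
    define \<delta> where "\<delta> = 1/2 * (1 - x T) * (1/2 - c)"
    have "\<delta> > 0"
      using x(2)[of T] c by (simp add: \<delta>_def)
    have descent: "x (T + m) \<le> x T - real m * \<delta>" for m
    proof (induction m)
      case 0
      show ?case by simp
    next
      case (Suc m)
      let ?y = "x (T + m)"
      have "real m * \<delta> \<ge> 0"
        using \<open>\<delta> > 0\<close> by simp
      then have "?y \<le> x T"
        using Suc.IH by simp
      then have "\<delta> \<le> ?y * (1 - ?y) * (?y - a (T + m))"
        unfolding \<delta>_def using ge[of "T + m"] a[of "T + m"] c x(1,2)[of "T + m"] x(2)[of T]
        by (intro mult_mono) auto
      then have "x (T + Suc m) \<le> ?y - \<delta>"
        using step[of "T + m"] by (simp add: algebra_simps)
      then show ?case
        using Suc.IH by (simp add: algebra_simps)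
    qed
    \<comment> \<open>Since \<open>x T < 1\<close>, this many steps would make \<open>x\<close>
      negative.\<close>
    obtain m where "1 < real m * \<delta>"
      using reals_Archimedean3[OF \<open>\<delta> > 0\<close>] by blast
    then show False
      using descent[of m] x(1)[of "T + m"] x(2)[of T] by linarith
  qed
  then obtain K where K: "K \<ge> T" "x K < 1/2" by blast
  have "x k < 1/2" if "k \<ge> K" for k
    using that
  proof (induction k rule: dec_induct)
    case base
    show ?case by (fact K(2))
  next
    case (step k)
    then show ?case
      using assms(3)[of k] coda_step_less_half[OF x(1), of k "a k"] a[of k] c K(1) by simp
  qed
  then show ?thesis
    unfolding eventually_sequentially by blast
qed

section \<open>The mean action of the influencers\<close>

text \<open>For an agent without influencers the value is \<open>0\<close>, by division by \<open>0\<close>.\<close>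

definition mean_action ::
    "'a set \<Rightarrow> ('a \<times> 'a) set \<Rightarrow> ('a \<Rightarrow> nat \<Rightarrow> real) \<Rightarrow> 'a \<Rightarrow> nat \<Rightarrow> real" where
  "mean_action V E p i k =
     (\<Sum>j\<in>influencers V E i. real (action p j k)) / real (card (influencers V E i))"

lemma action_le_1: "action p i k \<le> 1"
  by (simp add: action_def)

lemma action_eq_0: "p i k < 1/2 \<Longrightarrow> action p i k = 0"
  by (simp add: action_def)

lemma finite_influencers: "finite V \<Longrightarrow> finite (influencers V E i)"
  by (simp add: influencers_def)

lemma mean_action_bounds: "0 \<le> mean_action V E p i k" "mean_action V E p i k \<le> 1"
proof -
  show "0 \<le> mean_action V E p i k"
    by (simp add: mean_action_def sum_nonneg)
  have "(\<Sum>j\<in>influencers V E i. real (action p j k)) \<le> (\<Sum>j\<in>influencers V E i. 1)"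
    using action_le_1 by (intro sum_mono) (simp add: of_nat_le_1_iff)
  then show "mean_action V E p i k \<le> 1"
    by (auto simp: mean_action_def divide_le_eq_1 simp del: of_nat_sum)
qed

text \<open>Influencers in \<open>B\<close> contribute nothing, the others at most \<open>1\<close>
  each. Both majority conditions act through this bound.\<close>

lemma mean_action_le:
  assumes "finite V" "\<And>j. j \<in> B \<Longrightarrow> action p j k = 0"
  shows "mean_action V E p i k
    \<le> real (card (influencers V E i - B)) / real (card (influencers V E i))"
proof -
  let ?N = "influencers V E i"
  have "(\<Sum>j\<in>?N. real (action p j k)) = (\<Sum>j\<in>?N - B. real (action p j k))"
    using assms finite_influencers by (intro sum.mono_neutral_right) auto
  also have "\<dots> \<le> (\<Sum>j\<in>?N - B. 1)"
    using action_le_1 by (intro sum_mono) (simp add: of_nat_le_1_iff)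
  finally show ?thesis
    by (simp add: mean_action_def divide_right_mono del: of_nat_sum)
qed

lemma card_influencers_split:
  assumes "finite V"
  shows "card (influencers V E i)
    = card (influencers V E i \<inter> B) + card (influencers V E i - B)"
  using card_Int_Diff[OF finite_influencers[OF assms]] .

section \<open>Opinions along a fixed trajectory\<close>

context
  fixes V :: "'a set" and E :: "('a \<times> 'a) set" and p :: "'a \<Rightarrow> nat \<Rightarrow> real"
  assumes fin: "finite V" and coda: "coda_trajectory V E p"
begin

text \<open>Reduces each agent to the scalar recursion. Without influencers the mean would be
  \<open>0\<close> by convention and the formula would make a constant opinion decrease.\<close>

lemma opinion_Suc:
  assumes "i \<in> V" "card (influencers V E i) \<noteq> 0"
  shows "p i (Suc k) = p i k + p i k * (1 - p i k) * (mean_action V E p i k - p i k)"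
proof -
  have "p i (Suc k) = p i k + p i k * (1 - p i k) / real (card (influencers V E i)) *
      (\<Sum>j\<in>influencers V E i. real (action p j k) - p i k)"
    using coda assms by (simp add: coda_trajectory_def)
  then show ?thesis
    using assms(2) by (simp add: mean_action_def sum_subtractf field_simps del: of_nat_sum)
qed

lemma opinion_Suc_isolated:
  assumes "i \<in> V" "card (influencers V E i) = 0"
  shows "p i (Suc k) = p i k"
  using coda assms unfolding coda_trajectory_def by simp

lemma opinion_bounds:
  assumes "i \<in> V"
  shows "0 < p i k \<and> p i k < 1"
proof (induction k)
  case 0
  show ?case using coda assms by (simp add: coda_trajectory_def)
next
  case (Suc k)
  show ?case
  proof (cases "card (influencers V E i) = 0")
    case True
    then show ?thesis using Suc opinion_Suc_isolated[OF assms] by simp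
  next
    case False
    then show ?thesis
      using Suc coda_step_bounds[of "p i k" "mean_action V E p i k"]
      by (simp add: opinion_Suc[OF assms] mean_action_bounds)
  qed
qed

text \<open>The induction treats all of \<open>B\<close> at once, as the mean action of one member
  involves the others. Opinions are tracked instead of actions because action \<open>0\<close> can
  also occur at \<open>1/2\<close>, where a mean of \<open>1/2\<close> keeps the opinion.\<close>

lemma robust_polarized_cluster_invariant:
  assumes "robust_polarized_cluster V E p B" "i\<^sub>0 \<in> B" "action p i\<^sub>0 0 = 0" "i \<in> B"
  shows "p i k < 1/2"
  using \<open>i \<in> B\<close>
proof (induction k arbitrary: i)
  case 0
  have "action p i 0 = 0"
    using assms(1-3) 0 unfolding robust_polarized_cluster_def by metis
  \<comment> \<open>At time \<open>0\<close> the guard \<open>k > 0\<close> disables the tie clause,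
    so action \<open>0\<close> forces an opinion below \<open>1/2\<close>.\<close>
  then show ?case by (simp add: action_def split: if_splits)
next
  case (Suc k)
  let ?N = "influencers V E i"
  have "i \<in> V" and half: "card (?N - B) \<le> card (?N \<inter> B)"
    using assms(1) Suc.prems unfolding robust_polarized_cluster_def by auto
  show ?case
  proof (cases "card ?N = 0")
    case True
    then show ?thesis using Suc opinion_Suc_isolated[OF \<open>i \<in> V\<close>] by simp
  next
    case False
    have "mean_action V E p i k \<le> real (card (?N - B)) / real (card ?N)"
      using Suc.IH by (intro mean_action_le fin action_eq_0)
    also have "\<dots> \<le> 1/2"
      using half False card_influencers_split[OF fin, of E i B] by (simp add: divide_le_eq)
    finally show ?thesis
      using Suc coda_step_less_half opinion_bounds[OF \<open>i \<in> V\<close>] opinion_Suc[OF \<open>i \<in> V\<close> False]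
      by simp
  qed
qed

text \<open>The share of influencers outside \<open>B\<close> serves as the constant
  \<open>c\<close>; the strict majority puts it below \<open>1/2\<close> and ensures that
  influencers exist.\<close>

lemma opinion_below_half_eventually:
  assumes "i \<in> V" and maj: "card (influencers V E i \<inter> B) > card (influencers V E i - B)"
    and zero: "\<And>j k. j \<in> B \<Longrightarrow> k \<ge> T \<Longrightarrow> action p j k = 0"
  shows "\<forall>\<^sub>F k in sequentially. p i k < 1/2"
proof (rule coda_step_below_half_eventually)
  let ?N = "influencers V E i"
  have nz: "card ?N \<noteq> 0"
    using maj card_influencers_split[OF fin, of E i B] by simp
  show "0 < p i k" "p i k < 1" for k
    using opinion_bounds[OF assms(1)] by auto
  show "p i (Suc k) = p i k + p i k * (1 - p i k) * (mean_action V E p i k - p i k)" for k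
    using opinion_Suc[OF assms(1) nz] .
  show "mean_action V E p i k \<le> real (card (?N - B)) / real (card ?N)" if "k \<ge> T" for k
    using that zero by (intro mean_action_le fin)
  show "real (card (?N - B)) / real (card ?N) < 1/2"
    using maj nz card_influencers_split[OF fin, of E i B] by (simp add: field_simps)
qed

lemma chain_below_half_eventually:
  fixes h :: nat
  assumes sub: "\<forall>h\<in>{1..d}. A h \<subseteq> V"
    and cluster: "robust_polarized_cluster V E p (A 1)"
    and zero: "\<exists>i\<in>A 1. action p i 0 = 0"
    and maj: "\<forall>h\<in>{1..d - 1}. \<forall>i\<in>A (h + 1).
           card (influencers V E i \<inter> A h) > card (influencers V E i - A h)"
    and h: "1 \<le> h" "h \<le> d"
  shows "\<exists>T. \<forall>k\<ge>T. \<forall>i\<in>A h. p i k < 1/2"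
  using h
proof (induction h rule: dec_induct)
  case base
  show ?case
    using zero robust_polarized_cluster_invariant[OF cluster] by blast
next
  case (step h)
  then obtain T where T: "\<And>k i. k \<ge> T \<Longrightarrow> i \<in> A h \<Longrightarrow> p i k < 1/2"
    by auto
  have AV: "A (Suc h) \<subseteq> V"
    using sub step by auto
  have "\<forall>i\<in>A (Suc h). card (influencers V E i \<inter> A h) > card (influencers V E i - A h)"
    using maj step by auto
  then have "\<forall>i\<in>A (Suc h). \<forall>\<^sub>F k in sequentially. p i k < 1/2"
    using AV T by (blast intro: opinion_below_half_eventually action_eq_0)
  \<comment> \<open>Settling times depend on the agent; finiteness of \<open>A (Suc h)\<close>
    yields a common one.\<close>
  then have "\<forall>\<^sub>F k in sequentially. \<forall>i\<in>A (Suc h). p i k < 1/2"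
    using finite_subset[OF AV fin] by (simp add: eventually_ball_finite)
  then show ?case
    by (simp add: eventually_sequentially)
qed

end

text \<open>\<open>lim\<close> is meaningful only for convergent sequences, so its bound is
  conditional, while the \<open>limsup\<close> bound always applies.\<close>

theorem proposition10:
  fixes n d :: nat
    and E :: "(nat \<times> nat) set"
    and p :: "nat \<Rightarrow> nat \<Rightarrow> real"
    and A :: "nat \<Rightarrow> nat set"
  assumes "loopfree_graph {1..n} E"
    and "coda_trajectory {1..n} E p"
    and "d \<ge> 1"
    and "\<forall>h\<in>{1..d}. A h \<subseteq> {1..n}"
    and "robust_polarized_cluster {1..n} E p (A 1)"
    and "\<exists>i\<in>A 1. action p i 0 = 0"
    and "\<forall>h\<in>{1..d - 1}. \<forall>i\<in>A (h + 1).
           card (influencers {1..n} E i \<inter> A h) > card (influencers {1..n} E i - A h)"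
  shows "(\<exists>T :: nat \<Rightarrow> nat. T 1 = 0 \<and>
            (\<forall>h\<in>{1..d}. \<forall>k\<ge>T h. \<forall>i\<in>A h. action p i k = 0)) \<and>
         (\<forall>i\<in>(\<Union>h\<in>{1..d}. A h).
            limsup (\<lambda>k. ereal (p i k)) \<le> ereal (1/2) \<and>
            (convergent (p i) \<longrightarrow> lim (p i) \<le> 1/2))"
proof -
  have fin: "finite {1..n}" by simp
  note coda = assms(2)
  have "\<forall>h\<in>{1..d}. \<exists>T. \<forall>k\<ge>T. \<forall>i\<in>A h. p i k < 1/2"
    using chain_below_half_eventually[OF fin coda assms(4-7)] by simp
  then obtain T where T: "\<And>h k i. h \<in> {1..d} \<Longrightarrow> k \<ge> T h \<Longrightarrow> i \<in> A h \<Longrightarrow> p i k < 1/2"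
    by metis
  \<comment> \<open>The chosen \<open>T 1\<close> is arbitrary; a bound from time \<open>0\<close>
    on justifies resetting it to \<open>0\<close>.\<close>
  have T1: "p i k < 1/2" if "i \<in> A 1" for i k
    using assms(6) robust_polarized_cluster_invariant[OF fin coda assms(5)] that by blast
  have "\<exists>T :: nat \<Rightarrow> nat. T 1 = 0 \<and>
      (\<forall>h\<in>{1..d}. \<forall>k\<ge>T h. \<forall>i\<in>A h. action p i k = 0)"
    by (rule exI[of _ "T(1 := 0)"]) (use T T1 in \<open>auto intro!: action_eq_0\<close>)
  moreover have "limsup (\<lambda>k. ereal (p i k)) \<le> ereal (1/2) \<and>
      (convergent (p i) \<longrightarrow> lim (p i) \<le> 1/2)" if "i \<in> (\<Union>h\<in>{1..d}. A h)" for i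
  proof -
    obtain h where "h \<in> {1..d}" "i \<in> A h"
      using \<open>i \<in> (\<Union>h\<in>{1..d}. A h)\<close> by blast
    then have ev: "\<forall>\<^sub>F k in sequentially. p i k \<le> 1/2"
      unfolding eventually_sequentially using T less_imp_le by blast
    then have "limsup (\<lambda>k. ereal (p i k)) \<le> ereal (1/2)"
      by (intro Limsup_bounded) simp
    moreover have "lim (p i) \<le> 1/2" if "convergent (p i)"
      using tendsto_upperbound[OF _ ev] that by (simp add: convergent_LIMSEQ_iff)
    ultimately show ?thesis by blast
  qed
  ultimately show ?thesis by blast
qed

end
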